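(* Let $X_1,X_2,\dots$ be a sequence of non-empty $\infty$-pseudo-metric spaces of finite asymptotic dimension such that $X_i$ is $2i$-discrete for each $i\ge 1$. For each integer $k\ge1$ let $\alpha(k)$ be the asymptotic dimension of $\prod_{i=1}^k X_i$. Then $(1,\alpha)$ is an integral APD profile of $\prod_{i=1}^\infty X_i$. This holds when all products are given the $l_1$-$\infty$-pseudo-metric, and also when all products are given the supremum-$\infty$-pseudo-metric.
   Context: An $\infty$-pseudo-metric space is a set $X$ with $d:X\times X\to[0,\infty]$ such that $d(x,x)=0$, $d(x,y)=d(y,x)$, and $d(x,y)\le d(x,z)+d(z,y)$ whenever $d(x,z),d(z,y)<\infty$. $B(x,r)=\{y: d(x,y)<r\}$. A space is $c$-discrete if $d(x,y)\ge c$ for all $x\ne y$. On a (finite or infinite) product, the $l_1$-$\infty$-pseudo-metric is $\sum_i d_i(x_i,y_i)$ and the supremum-$\infty$-pseudo-metric is $\sup_i d_i(x_i,y_i)$. Asymptotic dimension: $\mathrm{asdim}(X)\le n$ (integer $n\ge 0$) if for every real $r>0$ there are subsets $X_0,\dots,X_n$ covering $X$ such that each $X_i$ is the union of a uniformly bounded family of sets (diameters at most some $S$) that is $r$-disjoint (points belonging to different members are at distance at least $r$). $\mathrm{asdim}(X)$ is the least such $n\ge 0$. Scale-$r$-dimension: for $A\subset X$ and $r>0$, a scale-$r$-chain in $A$ is a finite sequence $x_0,\dots,x_k$ of points of $A$ with $B(x_i,r)\cap B(x_{i+1},r)\neq\emptyset$ for $0\le i<k$ (balls in $X$). The scale-$r$-component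 of $x\in A$ is the set of points of $A$ that can be joined to $x$ by a scale-$r$-chain in $A$. $A$ is of scale-$r$-dimension $0$ if the supremum of the diameters of its scale-$r$-components is finite. For an integer $t\ge 0$, "$A$ has scale-$r$-dimension at most $t-1$" means $A$ is a union of $t$ subsets of scale-$r$-dimension $0$ (so $A=\emptyset$ if $t=0$). Integral APD profile: $(1,\alpha)$, where $1$ denotes the constant function and $\alpha$ is a function from positive integers to non-negative integers, is an integral APD profile of $X$ if $\alpha$ is non-decreasing and for all positive integers $r_0\le r_1$, $X$ is a union of subsets $Z_0,Z_1$ such that $Z_0$ has scale-$r_0$-dimension $0$ and $Z_1$ has scale-$r_1$-dimension at most $\alpha(r_0)-1$. *)

theory Defs
  imports "HOL-Analysis.Analysis" "HOL-Library.Extended_Nat"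
begin

text \<open>Spaces are pairs of a carrier set and a distance function; the values of the distance
  outside the carrier are irrelevant.\<close>

definition inf_pseudo_metric :: "'a set \<Rightarrow> ('a \<Rightarrow> 'a \<Rightarrow> ennreal) \<Rightarrow> bool" where
  "inf_pseudo_metric X d \<longleftrightarrow>
     (\<forall>x\<in>X. d x x = 0) \<and>
     (\<forall>x\<in>X. \<forall>y\<in>X. d x y = d y x) \<and>
     (\<forall>x\<in>X. \<forall>y\<in>X. \<forall>z\<in>X. d x z < \<infinity> \<longrightarrow> d z y < \<infinity> \<longrightarrow> d x y \<le> d x z + d z y)"

definition ipm_ball :: "'a set \<Rightarrow> ('a \<Rightarrow> 'a \<Rightarrow> ennreal) \<Rightarrow> 'a \<Rightarrow> real \<Rightarrow> 'a set" where
  "ipm_ball X d x r = {y \<in> X. d x y < ennreal r}"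

definition ipm_diam :: "('a \<Rightarrow> 'a \<Rightarrow> ennreal) \<Rightarrow> 'a set \<Rightarrow> ennreal" where
  "ipm_diam d A = (SUP x\<in>A. SUP y\<in>A. d x y)"

definition discrete_space :: "real \<Rightarrow> 'a set \<Rightarrow> ('a \<Rightarrow> 'a \<Rightarrow> ennreal) \<Rightarrow> bool" where
  "discrete_space c X d \<longleftrightarrow> (\<forall>x\<in>X. \<forall>y\<in>X. x \<noteq> y \<longrightarrow> ennreal c \<le> d x y)"

text \<open>Product distances on \<open>PiE I X\<close>. In \<open>ennreal\<close> every family is summable, so \<open>infsum\<close> is the
  genuine sum with values in \<open>[0, \<infinity>]\<close>, for finite and infinite \<open>I\<close> alike.\<close>

definition l1_prod :: "'i set \<Rightarrow> ('i \<Rightarrow> 'a \<Rightarrow> 'a \<Rightarrow> ennreal) \<Rightarrow> ('i \<Rightarrow> 'a) \<Rightarrow> ('i \<Rightarrow> 'a) \<Rightarrow> ennreal"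
  where "l1_prod I d x y = infsum (\<lambda>i. d i (x i) (y i)) I"

definition sup_prod :: "'i set \<Rightarrow> ('i \<Rightarrow> 'a \<Rightarrow> 'a \<Rightarrow> ennreal) \<Rightarrow> ('i \<Rightarrow> 'a) \<Rightarrow> ('i \<Rightarrow> 'a) \<Rightarrow> ennreal"
  where "sup_prod I d x y = (SUP i\<in>I. d i (x i) (y i))"

definition uniformly_bounded :: "('a \<Rightarrow> 'a \<Rightarrow> ennreal) \<Rightarrow> 'a set set \<Rightarrow> bool" where
  "uniformly_bounded d \<U> \<longleftrightarrow> (\<exists>S::real. \<forall>U\<in>\<U>. ipm_diam d U \<le> ennreal S)"

definition r_disjoint :: "('a \<Rightarrow> 'a \<Rightarrow> ennreal) \<Rightarrow> real \<Rightarrow> 'a set set \<Rightarrow> bool" where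
  "r_disjoint d r \<U> \<longleftrightarrow>
     (\<forall>U\<in>\<U>. \<forall>V\<in>\<U>. U \<noteq> V \<longrightarrow> (\<forall>x\<in>U. \<forall>y\<in>V. ennreal r \<le> d x y))"

definition asdim_le :: "'a set \<Rightarrow> ('a \<Rightarrow> 'a \<Rightarrow> ennreal) \<Rightarrow> nat \<Rightarrow> bool" where
  "asdim_le X d n \<longleftrightarrow>
     (\<forall>r::real. r > 0 \<longrightarrow>
       (\<exists>F :: nat \<Rightarrow> 'a set. X = (\<Union>i\<le>n. F i) \<and>
         (\<forall>i\<le>n. \<exists>\<U>. F i = \<Union>\<U> \<and> uniformly_bounded d \<U> \<and> r_disjoint d r \<U>)))"

text \<open>The least \<open>n\<close> with \<open>asdim_le X d n\<close>, and \<open>\<infinity>\<close> if there is none.\<close>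

definition asdim :: "'a set \<Rightarrow> ('a \<Rightarrow> 'a \<Rightarrow> ennreal) \<Rightarrow> enat" where
  "asdim X d = (INF n\<in>{n. asdim_le X d n}. enat n)"

definition scale_chain ::
  "'a set \<Rightarrow> ('a \<Rightarrow> 'a \<Rightarrow> ennreal) \<Rightarrow> real \<Rightarrow> 'a set \<Rightarrow> 'a list \<Rightarrow> bool" where
  "scale_chain X d r A xs \<longleftrightarrow>
     xs \<noteq> [] \<and> set xs \<subseteq> A \<and>
     (\<forall>i. Suc i < length xs \<longrightarrow>
        ipm_ball X d (xs ! i) r \<inter> ipm_ball X d (xs ! Suc i) r \<noteq> {})"

definition scale_component ::
  "'a set \<Rightarrow> ('a \<Rightarrow> 'a \<Rightarrow> ennreal) \<Rightarrow> real \<Rightarrow> 'a set \<Rightarrow> 'a \<Rightarrow> 'a set" where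
  "scale_component X d r A x = {y \<in> A. \<exists>xs. scale_chain X d r A xs \<and> hd xs = x \<and> last xs = y}"

definition scale_dim_zero ::
  "'a set \<Rightarrow> ('a \<Rightarrow> 'a \<Rightarrow> ennreal) \<Rightarrow> real \<Rightarrow> 'a set \<Rightarrow> bool" where
  "scale_dim_zero X d r A \<longleftrightarrow>
     (SUP x\<in>A. ipm_diam d (scale_component X d r A x)) < \<infinity>"

text \<open>\<open>scale_dim_less X d r A t\<close> says that \<open>A\<close> has scale-\<open>r\<close>-dimension at most \<open>t - 1\<close>, where
  \<open>t - 1\<close> is an integer, equal to \<open>-1\<close> for \<open>t = 0\<close> (in which case \<open>A\<close> is empty).\<close>

definition scale_dim_less ::
  "'a set \<Rightarrow> ('a \<Rightarrow> 'a \<Rightarrow> ennreal) \<Rightarrow> real \<Rightarrow> 'a set \<Rightarrow> nat \<Rightarrow> bool" where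
  "scale_dim_less X d r A t \<longleftrightarrow>
     (\<exists>F :: nat \<Rightarrow> 'a set. A = (\<Union>i<t. F i) \<and> (\<forall>i<t. scale_dim_zero X d r (F i)))"

text \<open>\<open>(1, \<alpha>)\<close> is an integral APD profile of \<open>X\<close>, the first entry being the constant function 1.
  Only the values of \<open>\<alpha>\<close> at positive integers matter.\<close>

definition integral_APD_profile_1 ::
  "'a set \<Rightarrow> ('a \<Rightarrow> 'a \<Rightarrow> ennreal) \<Rightarrow> (nat \<Rightarrow> nat) \<Rightarrow> bool" where
  "integral_APD_profile_1 X d \<alpha> \<longleftrightarrow>
     mono_on {1..} \<alpha> \<and>
     (\<forall>r0 r1. 1 \<le> r0 \<longrightarrow> r0 \<le> r1 \<longrightarrow>
       (\<exists>Z0 Z1. X = Z0 \<union> Z1 \<and>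
          scale_dim_zero X d (real r0) Z0 \<and>
          scale_dim_less X d (real r1) Z1 (\<alpha> r0)))"

end

theory Submission
  imports Defs
begin

text \<open>Put \<open>k = r0\<close> and \<open>n = \<alpha> k\<close>. At scale \<open>r1\<close> only the coordinates \<open>i \<le> r1\<close> can move; write them as
  \<open>P \<times> Q\<close>, where \<open>P\<close> uses \<open>i \<le> k\<close>. At scale \<open>r0\<close> only \<open>P\<close> can move, but the asymptotic dimension
  of \<open>P \<times> Q\<close> may exceed \<open>n\<close>. Cover \<open>Q\<close> by finitely many sets \<open>B j\<close> of dimension zero at scale \<open>r1\<close>, and
  for each \<open>j\<close> decompose \<open>P\<close> into a set \<open>D j\<close> and a wall coloured with \<open>n\<close> colours, all of dimension
  zero at scale \<open>r1\<close>. Over points of \<open>B j\<close> the set \<open>Z0\<close> uses \<open>D j\<close>, and \<open>Z1\<close> uses the wall. If the walls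
  are in general position, so that equally coloured parts of different walls are far apart, then a
  chain inside one colour of \<open>Z1\<close> cannot change \<open>j\<close>, and hence it is bounded in both factors.

  Dimension zero at a scale is expressed by a labelling that is constant along small steps and
  has bounded fibres.\<close>

section \<open>Sets of dimension zero at a given scale\<close>

definition zero_dim_at :: "('a \<Rightarrow> 'a \<Rightarrow> ennreal) \<Rightarrow> real \<Rightarrow> 'a set \<Rightarrow> bool" where
  "zero_dim_at d r A \<longleftrightarrow> (\<exists>(f :: 'a \<Rightarrow> 'a set) (S :: real).
     (\<forall>x\<in>A. \<forall>y\<in>A. d x y < ennreal r \<longrightarrow> f x = f y) \<and>
     (\<forall>x\<in>A. \<forall>y\<in>A. f x = f y \<longrightarrow> d x y \<le> ennreal S))"

text \<open>A definition cannot quantify over the type of labels, so \<open>zero_dim_at\<close>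
  fixes it to \<open>'a set\<close>. Labels of any type, such as the tuples used below, reduce to
  this case: replace each label by its fibre in \<open>A\<close>.\<close>

lemma zero_dim_atI:
  fixes f :: "'a \<Rightarrow> 'b" and S :: real
  assumes "\<And>x y. x \<in> A \<Longrightarrow> y \<in> A \<Longrightarrow> d x y < ennreal r \<Longrightarrow> f x = f y"
    and "\<And>x y. x \<in> A \<Longrightarrow> y \<in> A \<Longrightarrow> f x = f y \<Longrightarrow> d x y \<le> ennreal S"
  shows "zero_dim_at d r A"
proof -
  define g where "g x = {y \<in> A. f y = f x}" for x
  have g: "g x = g y \<longleftrightarrow> f x = f y" if "x \<in> A" "y \<in> A" for x y
    using that unfolding g_def by (auto; metis)
  show ?thesis
    unfolding zero_dim_at_def
    by (rule exI[of _ g], rule exI[of _ S]) (use assms g in auto)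
qed

lemma zero_dim_atE:
  assumes "zero_dim_at d r A"
  obtains f :: "'a \<Rightarrow> 'a set" and S :: real where
    "\<forall>x\<in>A. \<forall>y\<in>A. d x y < ennreal r \<longrightarrow> f x = f y"
    "\<forall>x\<in>A. \<forall>y\<in>A. f x = f y \<longrightarrow> d x y \<le> ennreal S"
  using assms unfolding zero_dim_at_def by (elim exE conjE)

text \<open>When an index \<open>i\<close> enters a label, one bound has to serve the fibres over
  all indices at once. As \<open>I\<close> is finite, the sum of the absolute values of the
  \<open>S i\<close> does.\<close>

lemma zero_dim_at_uniform:
  assumes "finite I" and "\<And>i. i \<in> I \<Longrightarrow> zero_dim_at (d i) r (A i)"
  obtains f :: "'i \<Rightarrow> 'a \<Rightarrow> 'a set" and S :: real where "S \<ge> 0"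
    and "\<forall>i\<in>I. \<forall>x\<in>A i. \<forall>y\<in>A i. d i x y < ennreal r \<longrightarrow> f i x = f i y"
    and "\<forall>i\<in>I. \<forall>x\<in>A i. \<forall>y\<in>A i. f i x = f i y \<longrightarrow> d i x y \<le> ennreal S"
proof -
  have "\<forall>i\<in>I. \<exists>(f :: 'a \<Rightarrow> 'a set) S. (\<forall>x\<in>A i. \<forall>y\<in>A i. d i x y < ennreal r \<longrightarrow> f x = f y) \<and>
      (\<forall>x\<in>A i. \<forall>y\<in>A i. f x = f y \<longrightarrow> d i x y \<le> ennreal S)"
    using assms(2) unfolding zero_dim_at_def by (intro ballI)
  from bchoice[OF this] obtain f :: "'i \<Rightarrow> 'a \<Rightarrow> 'a set" where
    "\<forall>i\<in>I. \<exists>S. (\<forall>x\<in>A i. \<forall>y\<in>A i. d i x y < ennreal r \<longrightarrow> f i x = f i y) \<and>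
      (\<forall>x\<in>A i. \<forall>y\<in>A i. f i x = f i y \<longrightarrow> d i x y \<le> ennreal S)" ..
  from bchoice[OF this] obtain S :: "'i \<Rightarrow> real" where
    "\<forall>i\<in>I. (\<forall>x\<in>A i. \<forall>y\<in>A i. d i x y < ennreal r \<longrightarrow> f i x = f i y) \<and>
      (\<forall>x\<in>A i. \<forall>y\<in>A i. f i x = f i y \<longrightarrow> d i x y \<le> ennreal (S i))" ..
  then have f: "\<And>i x y. i \<in> I \<Longrightarrow> x \<in> A i \<Longrightarrow> y \<in> A i \<Longrightarrow> d i x y < ennreal r \<Longrightarrow> f i x = f i y"
    and S: "\<And>i x y. i \<in> I \<Longrightarrow> x \<in> A i \<Longrightarrow> y \<in> A i \<Longrightarrow> f i x = f i y \<Longrightarrow> d i x y \<le> ennreal (S i)"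
    by simp_all
  have "S i \<le> (\<Sum>i\<in>I. \<bar>S i\<bar>)" if "i \<in> I" for i
    using member_le_sum[of i I "\<lambda>i. \<bar>S i\<bar>"] that assms(1) by auto
  then have "d i x y \<le> ennreal (\<Sum>i\<in>I. \<bar>S i\<bar>)"
    if "i \<in> I" "x \<in> A i" "y \<in> A i" "f i x = f i y" for i x y
    using S[OF that] that(1) by (meson ennreal_leI order_trans)
  with f show thesis
    by (intro that[of "\<Sum>i\<in>I. \<bar>S i\<bar>" f]) (auto intro: sum_nonneg)
qed

text \<open>To pass from a family to a labelling, label each point by a chosen member that contains
  it; points less than \<open>r\<close> apart cannot have different members chosen. Conversely, the
  fibres of a labelling form the family.\<close>

lemma asdim_le_iff_zero_dim_at:
  "asdim_le X d n \<longleftrightarrow>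
    (\<forall>r>0. \<exists>F. X = (\<Union>i\<le>n. F i) \<and> (\<forall>i\<le>n. zero_dim_at d r (F i)))"
proof -
  have "(\<exists>\<U>. A = \<Union>\<U> \<and> uniformly_bounded d \<U> \<and> r_disjoint d r \<U>) \<longleftrightarrow> zero_dim_at d r A"
    (is "?L \<longleftrightarrow> ?R") for A r
  proof
    assume ?L
    then obtain \<U> S where U: "A = \<Union>\<U>" and S: "\<And>U. U \<in> \<U> \<Longrightarrow> ipm_diam d U \<le> ennreal S"
      and dis: "r_disjoint d r \<U>"
      unfolding uniformly_bounded_def by auto
    have "\<forall>x\<in>A. \<exists>U. U \<in> \<U> \<and> x \<in> U" using U by auto
    then obtain f where f: "\<And>x. x \<in> A \<Longrightarrow> f x \<in> \<U> \<and> x \<in> f x" by metis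
    show ?R
    proof (rule zero_dim_atI[of A d r f S])
      fix x y assume "x \<in> A" "y \<in> A" "d x y < ennreal r"
      then show "f x = f y" using f dis unfolding r_disjoint_def by (meson not_le)
    next
      fix x y assume xy: "x \<in> A" "y \<in> A" "f x = f y"
      then have "x \<in> f x" "y \<in> f x" using f by auto
      then have "d x y \<le> ipm_diam d (f x)"
        unfolding ipm_diam_def by (intro SUP_upper2[of x] SUP_upper2[of y] order_refl)
      also have "\<dots> \<le> ennreal S" using S f xy by auto
      finally show "d x y \<le> ennreal S" .
    qed
  next
    assume ?R
    then obtain f :: "'a \<Rightarrow> 'a set" and S where
      f: "\<forall>x\<in>A. \<forall>y\<in>A. d x y < ennreal r \<longrightarrow> f x = f y"
      and S: "\<forall>x\<in>A. \<forall>y\<in>A. f x = f y \<longrightarrow> d x y \<le> ennreal S"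
      by (rule zero_dim_atE)
    define \<U> where "\<U> = (\<lambda>x. {y \<in> A. f y = f x}) ` A"
    have "A = \<Union>\<U>" unfolding \<U>_def by auto
    moreover have "uniformly_bounded d \<U>"
      unfolding uniformly_bounded_def \<U>_def ipm_diam_def
      by (rule exI[of _ S]) (use S in \<open>auto intro!: SUP_least\<close>)
    moreover have "r_disjoint d r \<U>"
      unfolding r_disjoint_def
    proof (intro ballI impI)
      fix U V x y assume "U \<in> \<U>" "V \<in> \<U>" "U \<noteq> V" "x \<in> U" "y \<in> V"
      then have "x \<in> A" "y \<in> A" "f x \<noteq> f y" unfolding \<U>_def by auto
      then show "ennreal r \<le> d x y" using f by (meson not_le)
    qed
    ultimately show ?L by blast
  qed
  then show ?thesis unfolding asdim_le_def by simp
qed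

section \<open>Bounds for asymptotic dimension\<close>

lemma asdim_leI_finite_cover:
  assumes "finite K" "K \<noteq> {}"
    and "\<And>r. r > 0 \<Longrightarrow> \<exists>F. X = (\<Union>k\<in>K. F k) \<and> (\<forall>k\<in>K. zero_dim_at d r (F k))"
  shows "asdim_le X d (card K - 1)"
  unfolding asdim_le_iff_zero_dim_at
proof (intro allI impI)
  fix r :: real assume "r > 0"
  then obtain F where F: "X = (\<Union>k\<in>K. F k)" "\<forall>k\<in>K. zero_dim_at d r (F k)"
    using assms(3) by blast
  obtain h where h: "bij_betw h {0..<card K} K"
    using ex_bij_betw_nat_finite[OF assms(1)] by blast
  have "card K > 0" using assms(1,2) by (simp add: card_gt_0_iff)
  then have "{..card K - 1} = {0..<card K}" by auto
  then have hK: "h ` {..card K - 1} = K" using h by (simp add: bij_betw_def)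
  have "(\<Union>i\<le>card K - 1. F (h i)) = (\<Union>k\<in>h ` {..card K - 1}. F k)" by simp
  then have "X = (\<Union>i\<le>card K - 1. F (h i))" unfolding hK using F(1) by simp
  moreover have "h i \<in> K" if "i \<le> card K - 1" for i using hK that by blast
  ultimately show "\<exists>F. X = (\<Union>i\<le>card K - 1. F i) \<and> (\<forall>i\<le>card K - 1. zero_dim_at d r (F i))"
    using F(2) by (intro exI[of _ "\<lambda>i. F (h i)"]) auto
qed

text \<open>Pieces and labels are pulled back along \<open>h\<close>. This serves to compare a
  product with a product over more coordinates.\<close>

lemma asdim_le_isometric_embedding:
  fixes h :: "'a \<Rightarrow> 'b"
  assumes "asdim_le Y e n" and "h ` X \<subseteq> Y"
    and "\<And>x y. x \<in> X \<Longrightarrow> y \<in> X \<Longrightarrow> e (h x) (h y) = d x y"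
  shows "asdim_le X d n"
  unfolding asdim_le_iff_zero_dim_at
proof (intro allI impI)
  fix r :: real assume "r > 0"
  then obtain F where F: "Y = (\<Union>i\<le>n. F i)" "\<forall>i\<le>n. zero_dim_at e r (F i)"
    using assms(1) unfolding asdim_le_iff_zero_dim_at by blast
  have "zero_dim_at d r {x \<in> X. h x \<in> F i}" if "i \<le> n" for i
  proof -
    have "zero_dim_at e r (F i)" using F(2) that by blast
    then obtain f :: "'b \<Rightarrow> 'b set" and S where
      f: "\<forall>x\<in>F i. \<forall>y\<in>F i. e x y < ennreal r \<longrightarrow> f x = f y"
      and S: "\<forall>x\<in>F i. \<forall>y\<in>F i. f x = f y \<longrightarrow> e x y \<le> ennreal S"
      by (rule zero_dim_atE)
    show ?thesis
    proof (rule zero_dim_atI[where f = "\<lambda>x. f (h x)" and S = S])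
      fix x y assume "x \<in> {x \<in> X. h x \<in> F i}" "y \<in> {x \<in> X. h x \<in> F i}" "d x y < ennreal r"
      then show "f (h x) = f (h y)" using f assms(3)[of x y] by simp
    next
      fix x y assume "x \<in> {x \<in> X. h x \<in> F i}" "y \<in> {x \<in> X. h x \<in> F i}" "f (h x) = f (h y)"
      then show "d x y \<le> ennreal S" using S assms(3)[of x y] by force
    qed
  qed
  moreover have "X = (\<Union>i\<le>n. {x \<in> X. h x \<in> F i})" using F(1) assms(2) by blast
  ultimately show "\<exists>F. X = (\<Union>i\<le>n. F i) \<and> (\<forall>i\<le>n. zero_dim_at d r (F i))"
    by (intro exI[of _ "\<lambda>i. {x \<in> X. h x \<in> F i}"]) auto
qed

lemma asdim_le_imp_asdim_le: "asdim_le X d n \<Longrightarrow> asdim X d \<le> enat n"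
  unfolding asdim_def by (auto intro: INF_lower)

lemma asdim_attained:
  assumes "asdim X d < \<infinity>"
  shows "asdim_le X d (the_enat (asdim X d))"
proof -
  have "\<exists>n. asdim_le X d n"
  proof (rule ccontr)
    assume "\<nexists>n. asdim_le X d n"
    then have "{n. asdim_le X d n} = {}" by simp
    then have "asdim X d = \<infinity>" unfolding asdim_def by (simp only: image_empty Inf_empty top_enat_def)
    with assms show False by simp
  qed
  then have "asdim_le X d (LEAST n. asdim_le X d n)" by (rule LeastI_ex)
  moreover from this have "asdim X d = enat (LEAST n. asdim_le X d n)"
    unfolding asdim_def by (intro antisym INF_lower INF_greatest) (auto intro: Least_le)
  ultimately show ?thesis by simp
qed

section \<open>Families with large multiplicity\<close>

lemma ipm_triangle:
  assumes "inf_pseudo_metric X d" "x \<in> X" "y \<in> X" "z \<in> X"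
  shows "d x y \<le> d x z + d z y"
proof (cases "d x z < \<infinity> \<and> d z y < \<infinity>")
  case True
  then show ?thesis using assms unfolding inf_pseudo_metric_def by blast
next
  case False
  then have "d x z = top \<or> d z y = top" by (auto simp: less_top[symmetric])
  then show ?thesis by (elim disjE) simp_all
qed

lemma ipm_sym: "inf_pseudo_metric X d \<Longrightarrow> x \<in> X \<Longrightarrow> y \<in> X \<Longrightarrow> d x y = d y x"
  unfolding inf_pseudo_metric_def by blast

lemma ipm_refl: "inf_pseudo_metric X d \<Longrightarrow> x \<in> X \<Longrightarrow> d x x = 0"
  unfolding inf_pseudo_metric_def by blast

text \<open>Balls of radius \<open>r\<close> that meet have centres less than \<open>2 * r\<close>
  apart, so a label at scale \<open>2 * r\<close> is constant along scale-\<open>r\<close>-chains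
  and each component lies in one fibre. This is the origin of the factor 2 in the scales of the
  final argument.\<close>

lemma zero_dim_at_imp_scale_dim_zero:
  assumes X: "inf_pseudo_metric X d" and "A \<subseteq> X" and "zero_dim_at d (2 * r) A" and "r > 0"
  shows "scale_dim_zero X d r A"
proof -
  obtain f :: "'a \<Rightarrow> 'a set" and S where f: "\<forall>x\<in>A. \<forall>y\<in>A. d x y < ennreal (2 * r) \<longrightarrow> f x = f y"
    and S: "\<forall>x\<in>A. \<forall>y\<in>A. f x = f y \<longrightarrow> d x y \<le> ennreal S"
    using assms(3) by (rule zero_dim_atE)
  have step: "f x = f y" if "x \<in> A" "y \<in> A" "ipm_ball X d x r \<inter> ipm_ball X d y r \<noteq> {}" for x y
  proof -
    from that(3) obtain z where z: "z \<in> X" "d x z < ennreal r" "d y z < ennreal r"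
      unfolding ipm_ball_def by auto
    have "d x y \<le> d x z + d z y" using ipm_triangle[OF X] that z assms(2) by blast
    also have "\<dots> < ennreal r + ennreal r"
      using z that ipm_sym[OF X, of y z] assms(2) by (intro add_strict_mono) auto
    also have "\<dots> = ennreal (2 * r)" using \<open>r > 0\<close> by (simp flip: ennreal_plus)
    finally show ?thesis using f that by blast
  qed
  have chain: "f (hd xs) = f (last xs)" if "scale_chain X d r A xs" for xs
  proof -
    have xs: "xs \<noteq> []" "set xs \<subseteq> A"
      "\<And>i. Suc i < length xs \<Longrightarrow> ipm_ball X d (xs ! i) r \<inter> ipm_ball X d (xs ! Suc i) r \<noteq> {}"
      using that unfolding scale_chain_def by auto
    have "f (xs ! 0) = f (xs ! i)" if "i < length xs" for i
      using that
    proof (induction i)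
      case (Suc i)
      then have "f (xs ! i) = f (xs ! Suc i)"
        using step[OF _ _ xs(3)[OF Suc.prems]] xs(2) by (simp add: subset_iff)
      with Suc show ?case by simp
    qed simp
    then show ?thesis using xs(1) by (simp add: hd_conv_nth last_conv_nth)
  qed
  have "(SUP x\<in>A. ipm_diam d (scale_component X d r A x)) \<le> ennreal S"
    unfolding ipm_diam_def scale_component_def
    by (intro SUP_least S[rule_format]) (auto dest!: chain)
  also have "\<dots> < \<infinity>" by simp
  finally show ?thesis unfolding scale_dim_zero_def .
qed

section \<open>Neighbourhoods, and covers with large multiplicity\<close>

definition enlarge :: "'a set \<Rightarrow> ('a \<Rightarrow> 'a \<Rightarrow> ennreal) \<Rightarrow> real \<Rightarrow> 'a set \<Rightarrow> 'a set" where
  "enlarge X d s V = {p \<in> X. \<exists>v\<in>V. d p v < ennreal s}"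

lemma enlarge_superset:
  "inf_pseudo_metric X d \<Longrightarrow> V \<subseteq> X \<Longrightarrow> s > 0 \<Longrightarrow> V \<subseteq> enlarge X d s V"
  unfolding enlarge_def by (auto simp: subset_iff ipm_refl intro!: bexI)

text \<open>Each point of the neighbourhood borrows the label of a point of \<open>V\<close> less
  than \<open>s\<close> away. The two detours cost \<open>2 * s\<close> in the scale and in the
  bound.\<close>

lemma zero_dim_at_enlarge:
  assumes X: "inf_pseudo_metric X d" and "V \<subseteq> X" and "zero_dim_at d (r + 2 * s) V"
    and "r > 0" "s > 0"
  shows "zero_dim_at d r (enlarge X d s V)"
proof -
  obtain f :: "'a \<Rightarrow> 'a set" and S where f: "\<forall>x\<in>V. \<forall>y\<in>V. d x y < ennreal (r + 2 * s) \<longrightarrow> f x = f y"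
    and S: "\<forall>x\<in>V. \<forall>y\<in>V. f x = f y \<longrightarrow> d x y \<le> ennreal S"
    using assms(3) by (rule zero_dim_atE)
  have "\<forall>p\<in>enlarge X d s V. \<exists>v\<in>V. d p v < ennreal s" unfolding enlarge_def by auto
  then obtain h where h: "\<And>p. p \<in> enlarge X d s V \<Longrightarrow> h p \<in> V \<and> d p (h p) < ennreal s"
    by metis
  have eX: "enlarge X d s V \<subseteq> X" unfolding enlarge_def by auto
  \<comment> \<open>\<open>ennreal\<close> sends a negative \<open>S\<close> to 0;
    \<open>max S 0\<close> has the same image, and the bounds can then be added as reals.\<close>
  show ?thesis
  proof (rule zero_dim_atI[where f = "\<lambda>p. f (h p)" and S = "s + (max S 0 + s)"])
    fix x y assume xy: "x \<in> enlarge X d s V" "y \<in> enlarge X d s V" "d x y < ennreal r"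
    then have X': "x \<in> X" "y \<in> X" "h x \<in> X" "h y \<in> X" using h assms(2) eX by auto
    have "d (h x) (h y) \<le> d (h x) x + d x (h y)" using ipm_triangle[OF X] X' by blast
    also have "\<dots> \<le> d (h x) x + (d x y + d y (h y))"
      using ipm_triangle[OF X] X' by (intro add_left_mono) blast
    also have "\<dots> < ennreal s + (ennreal r + ennreal s)"
      using h[OF xy(1)] h[OF xy(2)] xy(3) ipm_sym[OF X, of "h x" x] X'
      by (intro add_strict_mono) auto
    also have "\<dots> = ennreal (r + 2 * s)" using assms by (simp flip: ennreal_plus)
    finally show "f (h x) = f (h y)" using f h xy by blast
  next
    fix x y assume xy: "x \<in> enlarge X d s V" "y \<in> enlarge X d s V" "f (h x) = f (h y)"
    then have X': "x \<in> X" "y \<in> X" "h x \<in> X" "h y \<in> X" using h assms(2) eX by auto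
    have "d x y \<le> d x (h x) + d (h x) y" using ipm_triangle[OF X] X' by blast
    also have "\<dots> \<le> d x (h x) + (d (h x) (h y) + d (h y) y)"
      using ipm_triangle[OF X] X' by (intro add_left_mono) blast
    also have "\<dots> \<le> ennreal s + (ennreal (max S 0) + ennreal s)"
    proof (intro add_mono)
      have "d (h x) (h y) \<le> ennreal S" using S h xy by blast
      also have "\<dots> \<le> ennreal (max S 0)" by (simp add: ennreal_leI)
      finally show "d (h x) (h y) \<le> ennreal (max S 0)" .
    qed (use h[OF xy(1)] h[OF xy(2)] ipm_sym[OF X, of "h y" y] X' in auto)
    also have "\<dots> = ennreal (s + (max S 0 + s))" using assms by (simp flip: ennreal_plus)
    finally show "d x y \<le> ennreal (s + (max S 0 + s))" .
  qed
qed

text \<open>Induction on \<open>t\<close> in the manner of Kolmogorov's covering trick. After all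
  members are enlarged, the points whose multiplicity is still only \<open>t + 1\<close> form a set
  of dimension zero, which is added as a new member; all other points already have multiplicity at
  least \<open>t + 2\<close>.\<close>

lemma large_multiplicity_cover:
  assumes X: "inf_pseudo_metric X d" and "asdim_le X d n" and "r > 0"
  shows "\<exists>V. (\<forall>l<n+1+t. V l \<subseteq> X \<and> zero_dim_at d r (V l)) \<and>
           (\<forall>p\<in>X. t + 1 \<le> card {l. l < n+1+t \<and> p \<in> V l})"
  using \<open>r > 0\<close>
proof (induction t arbitrary: r)
  case 0
  then obtain F where F: "X = (\<Union>i\<le>n. F i)" "\<forall>i\<le>n. zero_dim_at d r (F i)"
    using assms(2) unfolding asdim_le_iff_zero_dim_at by blast
  have "0 < card {l. l < n+1+0 \<and> p \<in> F l}" if "p \<in> X" for p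
  proof -
    from that F(1) obtain l where "l \<le> n" "p \<in> F l" by blast
    then have "l \<in> {l. l < n+1+0 \<and> p \<in> F l}" by simp
    then have "{l. l < n+1+0 \<and> p \<in> F l} \<noteq> {}" by blast
    then show ?thesis by (simp add: card_gt_0_iff)
  qed
  moreover have "F l \<subseteq> X \<and> zero_dim_at d r (F l)" if "l < n+1+0" for l
    using F that by auto
  ultimately show ?case by (intro exI[of _ F]) (simp add: Suc_le_eq)
next
  case (Suc t)
  define N where "N = n + 1 + t"
  \<comment> \<open>Scale \<open>r + 2 * r\<close> for the old members leaves scale \<open>r\<close>
    after the enlargement by \<open>r\<close>.\<close>
  from Suc.IH[of "r + 2 * r"] Suc.prems obtain V where
    V: "\<And>l. l < N \<Longrightarrow> V l \<subseteq> X" "\<And>l. l < N \<Longrightarrow> zero_dim_at d (r + 2 * r) (V l)"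
    and card_V: "\<And>p. p \<in> X \<Longrightarrow> t + 1 \<le> card {l. l < N \<and> p \<in> V l}"
    unfolding N_def by auto
  define V' where "V' l = enlarge X d r (V l)" for l
  define G where "G p = {l. l < N \<and> p \<in> V l}" for p
  define G' where "G' p = {l. l < N \<and> p \<in> V' l}" for p
  have fin: "finite (G p)" "finite (G' p)" for p unfolding G_def G'_def by auto
  have sub: "G p \<subseteq> G' p" for p
    unfolding G_def G'_def V'_def using enlarge_superset[OF X V(1) Suc.prems] by blast
  define E where "E = {p \<in> X. card (G' p) = t + 1}"
  \<comment> \<open>At a point of \<open>E\<close> the count was at least \<open>t + 1\<close>
    before the enlargement and is \<open>t + 1\<close> after it, so no index was gained.\<close>
  have E: "G p = G' p" if "p \<in> E" for p
    using that card_V[of p] unfolding E_def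
    by (intro card_seteq[OF fin(2) sub]) (auto simp: G_def)
  have "zero_dim_at d r E"
  proof -
    have "zero_dim_at d (r + 2 * r) (V l)" if "l \<in> {..<N}" for l using V(2) that by simp
    from finite_lessThan this obtain f :: "nat \<Rightarrow> 'a \<Rightarrow> 'a set" and S :: real where
        "S \<ge> 0"
        and f_all: "\<forall>l\<in>{..<N}. \<forall>x\<in>V l. \<forall>y\<in>V l. d x y < ennreal (r + 2 * r) \<longrightarrow> f l x = f l y"
        and S_all: "\<forall>l\<in>{..<N}. \<forall>x\<in>V l. \<forall>y\<in>V l. f l x = f l y \<longrightarrow> d x y \<le> ennreal S"
      by (rule zero_dim_at_uniform)
    note f = f_all[rule_format] and S = S_all[rule_format]
    have G_near: "G p \<subseteq> G' p'" if "p \<in> X" "p' \<in> X" "d p p' < ennreal r" for p p'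
      using that ipm_sym[OF X, of p p'] unfolding G_def G'_def V'_def enlarge_def by force
    \<comment> \<open>For \<open>x\<close> and \<open>y\<close> in \<open>E\<close> less than
      \<open>r\<close> apart, \<open>G x\<close> lies in \<open>G' y = G y\<close>, and conversely,
      so the index set is constant along small steps. The label from any one of its indices then
      bounds the fibre.\<close>
    show ?thesis
    proof (rule zero_dim_atI[where f = "\<lambda>p. (G p, \<lambda>l\<in>G p. f l p)" and S = S])
      fix x y assume xy: "x \<in> E" "y \<in> E" "d x y < ennreal r"
      then have X': "x \<in> X" "y \<in> X" unfolding E_def by auto
      have "G x = G y"
        using G_near[of x y] G_near[of y x] ipm_sym[OF X X'] X' E xy by auto
      moreover have "f l x = f l y" if "l \<in> G x" for l
      proof (rule f)
        show "d x y < ennreal (r + 2 * r)"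
          using xy(3) Suc.prems by (meson less_le_trans ennreal_leI less_add_same_cancel1
              less_imp_le mult_pos_pos zero_less_numeral)
      qed (use that \<open>G x = G y\<close> in \<open>auto simp: G_def\<close>)
      ultimately show "(G x, \<lambda>l\<in>G x. f l x) = (G y, \<lambda>l\<in>G y. f l y)"
        by (auto intro: restrict_ext)
    next
      fix x y assume xy: "x \<in> E" "y \<in> E" "(G x, \<lambda>l\<in>G x. f l x) = (G y, \<lambda>l\<in>G y. f l y)"
      have "G x \<noteq> {}" using E[OF xy(1)] xy(1) unfolding E_def by auto
      then obtain l where l: "l \<in> G x" by blast
      then have "f l x = f l y" using xy(3) by (metis (no_types, lifting) prod.inject restrict_apply')
      moreover have "l \<in> G y" using xy(3) l by auto
      ultimately show "d x y \<le> ennreal S" using S[of l x y] l unfolding G_def by auto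
    qed
  qed
  moreover have "zero_dim_at d r (V' l)" "V' l \<subseteq> X" if "l < N" for l
    using zero_dim_at_enlarge[OF X V(1) V(2)] that Suc.prems
    unfolding V'_def enlarge_def by auto
  moreover have "E \<subseteq> X" unfolding E_def by auto
  moreover have "Suc t + 1 \<le> card {l. l < Suc N \<and> p \<in> (if l = N then E else V' l)}"
    if "p \<in> X" for p
  proof -
    have "t + 1 \<le> card (G' p)"
      using card_V[OF that] card_mono[OF fin(2) sub, of p] unfolding G_def by linarith
    moreover have "{l. l < Suc N \<and> p \<in> (if l = N then E else V' l)} =
        (if p \<in> E then insert N (G' p) else G' p)"
      unfolding G'_def by (auto simp: less_Suc_eq)
    moreover have "N \<notin> G' p" unfolding G'_def by auto
    ultimately show ?thesis using fin(2)[of p] that unfolding E_def by auto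
  qed
  ultimately show ?case
    unfolding N_def
    by (intro exI[of _ "\<lambda>l. if l = n + 1 + t then E else V' l"]) (auto simp: less_Suc_eq)
qed

section \<open>Walls in general position\<close>

text \<open>The wall \<open>P - D l\<close> is the complement of a set of dimension zero, and at most \<open>n\<close> walls meet
  even after thickening. A point \<open>p\<close> of the \<open>j\<close>-th wall is coloured by the number of later walls
  passing near \<open>p\<close>: if two walls \<open>j < j'\<close> meet, then the later walls near the
  intersection are counted for both, but \<open>j'\<close> itself is counted for \<open>j\<close> only, so the colours differ.
  The meaning of \<open>near\<close> has to depend on the colour to make the set of near
  walls locally constant on every colour class. There are \<open>n\<close> more families than the indices
  \<open>j \<le> m\<close> that are used, so that some later wall is far from \<open>p\<close>, which bounds the colour classes.\<close>

lemma walls_in_general_position: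
  fixes m n :: nat
  assumes X: "inf_pseudo_metric X d" and "asdim_le X d n" and "r > 0"
  obtains D :: "nat \<Rightarrow> 'a set" and A :: "nat \<Rightarrow> nat \<Rightarrow> 'a set" where
    "\<forall>j\<le>m. zero_dim_at d r (D j)"
    "\<forall>j\<le>m. X = D j \<union> (\<Union>a<n. A j a)"
    "\<forall>j\<le>m. \<forall>a<n. zero_dim_at d r (A j a)"
    "\<forall>j'\<le>m. \<forall>j<j'. \<forall>a<n. \<forall>p\<in>A j a. \<forall>p'\<in>A j' a. ennreal r \<le> d p p'"
proof -
  \<comment> \<open>Each point lies in at least \<open>m + 1\<close> of the \<open>M\<close> sets
    \<open>V l\<close>, so at most \<open>n\<close> of them miss it. The radius \<rho> exceeds
    \<open>n * r\<close>, so a wall thickened by \<open>n\<close> steps of length \<open>r\<close>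
    still misses \<open>V l\<close>.\<close>
  define M where "M = n + 1 + m"
  define \<rho> where "\<rho> = (real n + 1) * r"
  have "\<rho> > 0" unfolding \<rho>_def using \<open>r > 0\<close> by simp
  then obtain V where
    V: "\<And>l. l < M \<Longrightarrow> V l \<subseteq> X" "\<And>l. l < M \<Longrightarrow> zero_dim_at d (r + 2 * \<rho>) (V l)"
    and card_V: "\<And>p. p \<in> X \<Longrightarrow> m + 1 \<le> card {l. l < M \<and> p \<in> V l}"
    using large_multiplicity_cover[OF assms(1,2), of "r + 2 * \<rho>" m] \<open>r > 0\<close>
    unfolding M_def by auto
  define D where "D l = enlarge X d \<rho> (V l)" for l
  have DX: "D l \<subseteq> X" for l unfolding D_def enlarge_def by auto
  have D0: "zero_dim_at d r (D l)" if "l < M" for l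
    unfolding D_def using zero_dim_at_enlarge[OF X V(1) V(2)] that \<open>r > 0\<close> \<open>\<rho> > 0\<close> by blast
  \<comment> \<open>The wall thickened by \<open>s\<close> steps of length \<open>r\<close>; the
    inequality is not strict, so that \<open>s = 0\<close> keeps the wall itself.\<close>
  define W where "W l s = {p \<in> X. \<exists>w\<in>X - D l. d p w \<le> ennreal (real s * r)}" for l s
  have W0: "X - D l \<subseteq> W l s" for l s
    unfolding W_def using ipm_refl[OF X] by (auto intro!: bexI)
  have W_step: "p' \<in> W l (Suc s)" if "p \<in> W l s" "p' \<in> X" "d p p' < ennreal r" for p p' l s
  proof -
    from that(1) obtain w where w: "w \<in> X - D l" "d p w \<le> ennreal (real s * r)" and "p \<in> X"
      unfolding W_def by auto
    have "d p' w \<le> d p' p + d p w" using ipm_triangle[OF X] that(2) w(1) \<open>p \<in> X\<close> by blast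
    also have "\<dots> \<le> ennreal r + ennreal (real s * r)"
      using that(3) w(2) ipm_sym[OF X that(2) \<open>p \<in> X\<close>] by (intro add_mono) auto
    also have "\<dots> = ennreal (real (Suc s) * r)"
      using \<open>r > 0\<close> by (simp add: algebra_simps flip: ennreal_plus)
    finally show ?thesis using w(1) that(2) unfolding W_def by auto
  qed
  have W_mono: "W l s \<subseteq> W l (Suc s)" for l s
  proof
    fix p assume p: "p \<in> W l s"
    then have "p \<in> X" unfolding W_def by simp
    with p show "p \<in> W l (Suc s)" using W_step[of p l s p] ipm_refl[OF X] \<open>r > 0\<close> by simp
  qed
  have V_W: "p \<notin> W l s" if "p \<in> V l" "s \<le> n" "l < M" for p l s
  proof
    assume "p \<in> W l s"
    then obtain w where w: "w \<in> X - D l" "d p w \<le> ennreal (real s * r)" "p \<in> X"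
      unfolding W_def by auto
    have "real s * r < \<rho>" unfolding \<rho>_def using \<open>r > 0\<close> that(2) by simp
    then have "ennreal (real s * r) < ennreal \<rho>"
      using \<open>r > 0\<close> by (intro ennreal_lessI) (auto simp: \<open>\<rho> > 0\<close>)
    then have "d w p < ennreal \<rho>" using w(2) ipm_sym[OF X, of w p] w by auto
    then show False using w(1) that(1) unfolding D_def enlarge_def by auto
  qed
  define T where "T j p s = {l. j < l \<and> l < M \<and> p \<in> W l s}" for j p s
  have finT: "finite (T j p s)" for j p s unfolding T_def by auto
  have T_mono: "T j p s \<subseteq> T j p (Suc s)" for j p s unfolding T_def using W_mono by blast
  have T_step: "T j p s \<subseteq> T j p' (Suc s)" if "p' \<in> X" "d p p' < ennreal r" for j p p' s
    unfolding T_def using W_step that by blast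
  \<comment> \<open>At most \<open>n\<close> indices \<open>l\<close> have \<open>p\<close> outside
    \<open>V l\<close>. All of \<open>T j p s\<close> is among them, and \<open>j\<close> itself
    takes one more place, so fewer than \<open>n\<close> later walls are near
    \<open>p\<close>.\<close>
  have card_T: "card (T j p s) < n" if "j \<le> m" "p \<in> X - D j" "s \<le> n" for j p s
  proof -
    have "insert j (T j p s) \<subseteq> {..<M} - {l. l < M \<and> p \<in> V l}"
      using that V_W[of p _ s] W0[of j s] unfolding T_def M_def by auto
    then have "card (insert j (T j p s)) \<le> card ({..<M} - {l. l < M \<and> p \<in> V l})"
      by (intro card_mono) auto
    also have "\<dots> = M - card {l. l < M \<and> p \<in> V l}"
      by (subst card_Diff_subset) auto
    also have "\<dots> \<le> n" using card_V[of p] that(2) unfolding M_def by auto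
    finally show ?thesis using finT[of j p s] by (simp add: T_def)
  qed
  \<comment> \<open>Equal counts at thickness \<open>a\<close> and \<open>a + 1\<close> mean that
    the set of near walls is the same at both, because it grows with the thickness. The spare unit
    absorbs one step of length less than \<open>r\<close>.\<close>
  define A where "A j a = {p \<in> X - D j. card (T j p a) = a \<and> card (T j p (Suc a)) = a}" for j a
  have AX: "A j a \<subseteq> X" for j a unfolding A_def by auto
  have T_stable: "T j p (Suc a) = T j p a" if "p \<in> A j a" for j p a
    using that card_subset_eq[OF finT T_mono, of j p a] unfolding A_def by simp
  have cover: "X = D j \<union> (\<Union>a<n. A j a)" if "j \<le> m" for j
  proof -
    have "\<exists>a<n. p \<in> A j a" if p: "p \<in> X - D j" for p
    proof -
      have "0 < n" using card_T[OF \<open>j \<le> m\<close> p, of 0] by simp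
      \<comment> \<open>The count at thickness \<open>n\<close> is at most \<open>n - 1\<close>, so
        there is a first \<open>a\<close> for which the count at thickness \<open>a + 1\<close> is
        at most \<open>a\<close>. Minimality makes the count at thickness \<open>a\<close> at least
        \<open>a\<close>, and monotonicity makes both equal to \<open>a\<close>.\<close>
      define a where "a = (LEAST a. card (T j p (Suc a)) \<le> a)"
      have n1: "card (T j p (Suc (n - 1))) \<le> n - 1"
        using card_T[OF \<open>j \<le> m\<close> p, of n] \<open>0 < n\<close> by simp
      have a1: "card (T j p (Suc a)) \<le> a" unfolding a_def by (rule LeastI) (rule n1)
      have an: "a \<le> n - 1" unfolding a_def by (rule Least_le) (rule n1)
      have "a \<le> card (T j p a)"
      proof (cases a)
        case (Suc b)
        then have "\<not> card (T j p (Suc b)) \<le> b"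
          using not_less_Least[of b "\<lambda>a. card (T j p (Suc a)) \<le> a"] unfolding a_def[symmetric] by simp
        with Suc show ?thesis by simp
      qed simp
      moreover have "card (T j p a) \<le> card (T j p (Suc a))" using card_mono[OF finT T_mono] .
      ultimately show ?thesis using a1 an p \<open>0 < n\<close> unfolding A_def by (intro exI[of _ a]) auto
    qed
    then show ?thesis using DX[of j] AX[of j] by blast
  qed
  have apart: "ennreal r \<le> d p p'"
    if "j < j'" "j' \<le> m" "p \<in> A j a" "p' \<in> A j' a" for j j' a p p'
  proof (rule ccontr)
    assume "\<not> ennreal r \<le> d p p'"
    moreover have pX: "p \<in> X" "p' \<in> X" using that AX by auto
    ultimately have near: "d p' p < ennreal r" using ipm_sym[OF X, of p p'] by (simp add: not_le)
    \<comment> \<open>Moving from \<open>p'\<close> to \<open>p\<close> raises the thickness by one,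
      so the wall \<open>j'\<close> and the \<open>a\<close> later walls near \<open>p'\<close>
      would give \<open>a + 1\<close> indices in a set of size \<open>a\<close>.\<close>
    have "p \<in> W j' (Suc a)"
      using W_step[OF _ pX(1) near] W0[of j' a] that(4) unfolding A_def by blast
    then have "insert j' (T j' p' a) \<subseteq> T j p (Suc a)"
      using T_step[OF pX(1) near, of j' a] that(1,2) unfolding T_def M_def by auto
    then have "card (insert j' (T j' p' a)) \<le> card (T j p (Suc a))" by (intro card_mono finT)
    also have "\<dots> = a" using that(3) unfolding A_def by simp
    finally show False using that(4) finT[of j' p' a] unfolding A_def by (simp add: T_def)
  qed
  have A0: "zero_dim_at d r (A j a)" if "j \<le> m" "a < n" for j a
  proof -
    have "zero_dim_at d r (D l)" if "l \<in> {..<M}" for l using D0 that by simp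
    from finite_lessThan this obtain f :: "nat \<Rightarrow> 'a \<Rightarrow> 'a set" and S :: real where
        "S \<ge> 0"
        and f_all: "\<forall>l\<in>{..<M}. \<forall>x\<in>D l. \<forall>y\<in>D l. d x y < ennreal r \<longrightarrow> f l x = f l y"
        and S_all: "\<forall>l\<in>{..<M}. \<forall>x\<in>D l. \<forall>y\<in>D l. f l x = f l y \<longrightarrow> d x y \<le> ennreal S"
      by (rule zero_dim_at_uniform)
    note f = f_all[rule_format] and S = S_all[rule_format]
    \<comment> \<open>At least \<open>n\<close> indices below \<open>M\<close> follow
      \<open>j\<close>, and only \<open>a < n\<close> of their walls are near \<open>p\<close>, so
      \<open>p\<close> lies in \<open>D l\<close> for some later \<open>l\<close>. The least such
      index depends on \<open>T j p a\<close> alone, which is constant along small steps in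
      \<open>A j a\<close>.\<close>
    define far where "far p = (LEAST l. l \<in> {j<..<M} - T j p a)" for p
    have far: "far p < M" "p \<in> D (far p)" if "p \<in> A j a" for p
    proof -
      have "card (T j p a) < card {j<..<M}"
        using that \<open>j \<le> m\<close> \<open>a < n\<close> unfolding A_def M_def by auto
      then have "\<not> {j<..<M} \<subseteq> T j p a" using card_mono[OF finT] by (meson not_le)
      then have "far p \<in> {j<..<M} - T j p a" unfolding far_def by (metis DiffI LeastI subsetI)
      then show "far p < M" "p \<in> D (far p)"
        using W0[of "far p" a] that AX unfolding T_def by auto
    qed
    have far_eq: "far p = far p'" if "T j p a = T j p' a" for p p'
      using that unfolding far_def by simp
    show ?thesis
    proof (rule zero_dim_atI[where f = "\<lambda>p. (T j p a, f (far p) p)" and S = S])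
      fix x y assume xy: "x \<in> A j a" "y \<in> A j a" "d x y < ennreal r"
      then have X': "x \<in> X" "y \<in> X" using AX by auto
      have "T j x a = T j y a"
        using T_step[of y x j a] T_step[of x y j a] ipm_sym[OF X X'] X' xy T_stable by auto
      then show "(T j x a, f (far x) x) = (T j y a, f (far y) y)"
        using f[of "far x" x y] far[OF xy(1)] far[OF xy(2)] far_eq[of x y] xy(3) by auto
    next
      fix x y assume "x \<in> A j a" "y \<in> A j a" "(T j x a, f (far x) x) = (T j y a, f (far y) y)"
      then show "d x y \<le> ennreal S"
        using S[of "far x" x y] far[of x] far[of y] far_eq[of x y] by auto
    qed
  qed
  show thesis
  proof (rule that)
    show "\<forall>j\<le>m. zero_dim_at d r (D j)" using D0 unfolding M_def by simp
    show "\<forall>j\<le>m. X = D j \<union> (\<Union>a<n. A j a)" using cover by blast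
    show "\<forall>j\<le>m. \<forall>a<n. zero_dim_at d r (A j a)" using A0 by blast
    show "\<forall>j'\<le>m. \<forall>j<j'. \<forall>a<n. \<forall>p\<in>A j a. \<forall>p'\<in>A j' a. ennreal r \<le> d p p'"
      using apart by blast
  qed
qed

section \<open>Products\<close>

text \<open>Properties shared by the sum and the supremum, so that one argument serves both product
  distances. \<open>norm_component\<close> turns discreteness of a factor into a lower bound,
  \<open>norm_le_sum\<close> bounds distances over finitely many coordinates, and
  \<open>norm_support\<close> discards coordinates in which two points agree.\<close>

locale family_norm =
  fixes N :: "nat set \<Rightarrow> (nat \<Rightarrow> ennreal) \<Rightarrow> ennreal"
  assumes norm_cong: "(\<And>i. i \<in> I \<Longrightarrow> u i = v i) \<Longrightarrow> N I u = N I v"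
    and norm_mono: "(\<And>i. i \<in> I \<Longrightarrow> u i \<le> v i) \<Longrightarrow> N I u \<le> N I v"
    and norm_add: "N I (\<lambda>i. u i + v i) \<le> N I u + N I v"
    and norm_component: "i \<in> I \<Longrightarrow> u i \<le> N I u"
    and norm_le_sum: "finite I \<Longrightarrow> N I u \<le> sum u I"
    and norm_support: "J \<subseteq> I \<Longrightarrow> (\<And>i. i \<in> I - J \<Longrightarrow> u i = 0) \<Longrightarrow> N I u = N J u"
    and norm_subset: "J \<subseteq> I \<Longrightarrow> N J u \<le> N I u"
begin

definition dist_on :: "(nat \<Rightarrow> 'a \<Rightarrow> 'a \<Rightarrow> ennreal) \<Rightarrow> nat set \<Rightarrow> (nat \<Rightarrow> 'a) \<Rightarrow> (nat \<Rightarrow> 'a) \<Rightarrow> ennreal"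
  where "dist_on d I x y = N I (\<lambda>i. d i (x i) (y i))"

lemma inf_pseudo_metric_dist_on:
  assumes "\<And>i. i \<in> I \<Longrightarrow> inf_pseudo_metric (X i) (d i)"
  shows "inf_pseudo_metric (PiE I X) (dist_on d I)"
proof -
  have "dist_on d I x x = 0" if "x \<in> PiE I X" for x
  proof -
    \<comment> \<open>A vanishing family has the norm of the empty family, which the empty sum
      bounds by 0.\<close>
    have "dist_on d I x x = N {} (\<lambda>i. d i (x i) (x i))"
      unfolding dist_on_def using ipm_refl[OF assms] PiE_mem[OF that]
      by (intro norm_support) auto
    then show ?thesis using norm_le_sum[of "{}"] by simp
  qed
  moreover have "dist_on d I x y = dist_on d I y x" if "x \<in> PiE I X" "y \<in> PiE I X" for x y
    unfolding dist_on_def using ipm_sym[OF assms] PiE_mem[OF that(1)] PiE_mem[OF that(2)]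
    by (intro norm_cong) auto
  moreover have "dist_on d I x y \<le> dist_on d I x z + dist_on d I z y"
    if "x \<in> PiE I X" "y \<in> PiE I X" "z \<in> PiE I X" for x y z
  proof -
    have "dist_on d I x y \<le> N I (\<lambda>i. d i (x i) (z i) + d i (z i) (y i))"
      unfolding dist_on_def
      using ipm_triangle[OF assms] PiE_mem[OF that(1)] PiE_mem[OF that(2)] PiE_mem[OF that(3)]
      by (intro norm_mono) auto
    also have "\<dots> \<le> dist_on d I x z + dist_on d I z y" unfolding dist_on_def by (rule norm_add)
    finally show ?thesis .
  qed
  ultimately show ?thesis unfolding inf_pseudo_metric_def by blast
qed

text \<open>Products of pieces are labelled coordinatewise, and there is one for each tuple of
  indices. The bound is crude, but only finiteness is wanted from it.\<close>

lemma asdim_le_finite_product: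
  assumes "finite I" and "\<And>i. i \<in> I \<Longrightarrow> asdim_le (X i) (d i) (n i)"
  shows "\<exists>m. asdim_le (PiE I X) (dist_on d I) m"
proof -
  define K where "K = PiE I (\<lambda>i. {..n i})"
  have "asdim_le (PiE I X) (dist_on d I) (card K - 1)"
  proof (rule asdim_leI_finite_cover)
    show "finite K" "K \<noteq> {}" unfolding K_def using assms(1) by (auto simp: finite_PiE PiE_eq_empty_iff)
  next
    fix r :: real assume "r > 0"
    then have "\<forall>i\<in>I. \<exists>F. X i = (\<Union>k\<le>n i. F k) \<and> (\<forall>k\<le>n i. zero_dim_at (d i) r (F k))"
      using assms(2) unfolding asdim_le_iff_zero_dim_at by blast
    then obtain F where F: "\<And>i. i \<in> I \<Longrightarrow> X i = (\<Union>k\<le>n i. F i k)"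
      "\<And>i k. i \<in> I \<Longrightarrow> k \<le> n i \<Longrightarrow> zero_dim_at (d i) r (F i k)" by metis
    have "zero_dim_at (dist_on d I) r (PiE I (\<lambda>i. F i (k i)))" if "k \<in> K" for k
    proof -
      have "\<And>i. i \<in> I \<Longrightarrow> zero_dim_at (d i) r (F i (k i))"
        using F(2) that unfolding K_def by (auto dest: PiE_mem)
      with assms(1) obtain f :: "nat \<Rightarrow> 'a \<Rightarrow> 'a set" and S :: real where
        "S \<ge> 0"
        and f_all: "\<forall>i\<in>I. \<forall>x\<in>F i (k i). \<forall>y\<in>F i (k i). d i x y < ennreal r \<longrightarrow> f i x = f i y"
        and S_all: "\<forall>i\<in>I. \<forall>x\<in>F i (k i). \<forall>y\<in>F i (k i). f i x = f i y \<longrightarrow> d i x y \<le> ennreal S"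
      by (rule zero_dim_at_uniform)
    note f = f_all[rule_format] and S = S_all[rule_format]
      show ?thesis
      proof (rule zero_dim_atI[where f = "\<lambda>x. \<lambda>i\<in>I. f i (x i)" and S = "real (card I) * S"])
        fix x y
        assume xy: "x \<in> PiE I (\<lambda>i. F i (k i))" "y \<in> PiE I (\<lambda>i. F i (k i))" "dist_on d I x y < ennreal r"
        have "d i (x i) (y i) < ennreal r" if "i \<in> I" for i
          using norm_component[OF that, of "\<lambda>i. d i (x i) (y i)"] xy(3)
          unfolding dist_on_def by (rule le_less_trans)
        then show "(\<lambda>i\<in>I. f i (x i)) = (\<lambda>i\<in>I. f i (y i))"
          using f PiE_mem[OF xy(1)] PiE_mem[OF xy(2)] by (intro restrict_ext) blast
      next
        fix x y
        assume xy: "x \<in> PiE I (\<lambda>i. F i (k i))" "y \<in> PiE I (\<lambda>i. F i (k i))"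
          "(\<lambda>i\<in>I. f i (x i)) = (\<lambda>i\<in>I. f i (y i))"
        have "f i (x i) = f i (y i)" if "i \<in> I" for i
          using fun_cong[OF xy(3), of i] that by simp
        then have "d i (x i) (y i) \<le> ennreal S" if "i \<in> I" for i
          using S that PiE_mem[OF xy(1)] PiE_mem[OF xy(2)] by blast
        then have "dist_on d I x y \<le> (\<Sum>i\<in>I. ennreal S)"
          unfolding dist_on_def using norm_le_sum[OF assms(1)] by (meson order_trans sum_mono)
        also have "\<dots> = ennreal (real (card I) * S)"
          using \<open>S \<ge> 0\<close> by (simp add: ennreal_mult ennreal_of_nat_eq_real_of_nat)
        finally show "dist_on d I x y \<le> ennreal (real (card I) * S)" .
      qed
    qed
    moreover have "PiE I X = (\<Union>k\<in>K. PiE I (\<lambda>i. F i (k i)))"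
    proof (intro equalityI subsetI)
      fix x assume x: "x \<in> PiE I X"
      have "\<exists>k. k \<le> n i \<and> x i \<in> F i k" if "i \<in> I" for i
        using PiE_mem[OF x that] unfolding F(1)[OF that] by auto
      then obtain k where "\<And>i. i \<in> I \<Longrightarrow> k i \<le> n i \<and> x i \<in> F i (k i)" by metis
      then have "restrict k I \<in> K" "x \<in> PiE I (\<lambda>i. F i (restrict k I i))"
        using x unfolding K_def by (auto simp: PiE_iff)
      then show "x \<in> (\<Union>k\<in>K. PiE I (\<lambda>i. F i (k i)))" by blast
    next
      fix x assume "x \<in> (\<Union>k\<in>K. PiE I (\<lambda>i. F i (k i)))"
      then obtain k where k: "k \<in> K" "x \<in> PiE I (\<lambda>i. F i (k i))" by blast
      have "x i \<in> X i" if "i \<in> I" for i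
        using PiE_mem[OF k(2) that] PiE_mem[OF k(1)[unfolded K_def] that] unfolding F(1)[OF that] by auto
      then show "x \<in> PiE I X" using k(2) by (auto simp: PiE_iff)
    qed
    ultimately show "\<exists>F. PiE I X = (\<Union>k\<in>K. F k) \<and> (\<forall>k\<in>K. zero_dim_at (dist_on d I) r (F k))"
      by (intro exI[of _ "\<lambda>k. PiE I (\<lambda>i. F i (k i))"]) blast
  qed
  then show ?thesis ..
qed

text \<open>Missing coordinates are filled with fixed points \<open>e i\<close>, which contribute
  distance 0. This makes \<alpha> non-decreasing, and it is where non-emptiness of the factors
  enters.\<close>

lemma asdim_le_subproduct:
  assumes "asdim_le (PiE I X) (dist_on d I) n" and "J \<subseteq> I"
    and "\<And>i. i \<in> I \<Longrightarrow> inf_pseudo_metric (X i) (d i)" and "\<And>i. i \<in> I \<Longrightarrow> X i \<noteq> {}"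
  shows "asdim_le (PiE J X) (dist_on d J) n"
proof -
  have "\<forall>i\<in>I. \<exists>x. x \<in> X i" using assms(4) by (simp add: ex_in_conv)
  then obtain e where e: "\<And>i. i \<in> I \<Longrightarrow> e i \<in> X i" by metis
  define h where "h x = (\<lambda>i\<in>I. if i \<in> J then x i else e i)" for x
  show ?thesis
  proof (rule asdim_le_isometric_embedding[OF assms(1), of h])
    show "h ` PiE J X \<subseteq> PiE I X" unfolding h_def using e by (auto simp: PiE_iff)
  next
    fix x y assume "x \<in> PiE J X" "y \<in> PiE J X"
    have "dist_on d I (h x) (h y) = N J (\<lambda>i. d i (h x i) (h y i))"
      unfolding dist_on_def
      by (rule norm_support[OF assms(2)]) (use e ipm_refl[OF assms(3)] in \<open>auto simp: h_def\<close>)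
    also have "\<dots> = dist_on d J x y"
      unfolding dist_on_def by (rule norm_cong) (use assms(2) in \<open>auto simp: h_def\<close>)
    finally show "dist_on d I (h x) (h y) = dist_on d J x y" .
  qed
qed

text \<open>\<open>the_enat\<close> is meaningful only at finite arguments; the first conjunct
  ensures that the profile consists of actual dimensions.\<close>

lemma integral_APD_profile_dist_on:
  fixes X :: "nat \<Rightarrow> 'a set" and d :: "nat \<Rightarrow> 'a \<Rightarrow> 'a \<Rightarrow> ennreal"
  assumes ne: "\<And>i. i \<ge> 1 \<Longrightarrow> X i \<noteq> {}"
    and ipm: "\<And>i. i \<ge> 1 \<Longrightarrow> inf_pseudo_metric (X i) (d i)"
    and fin: "\<And>i. i \<ge> 1 \<Longrightarrow> asdim (X i) (d i) < \<infinity>"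
    and discrete: "\<And>i. i \<ge> 1 \<Longrightarrow> discrete_space (2 * real i) (X i) (d i)"
  shows "(\<forall>k\<ge>1. asdim (PiE {1..k} X) (dist_on d {1..k}) < \<infinity>) \<and>
    integral_APD_profile_1 (PiE {1..} X) (dist_on d {1..})
      (\<lambda>k. the_enat (asdim (PiE {1..k} X) (dist_on d {1..k})))"
proof -
  have ex_asdim_le: "\<exists>m. asdim_le (PiE I X) (dist_on d I) m" if "finite I" "I \<subseteq> {1..}" for I
  proof (rule asdim_le_finite_product[OF that(1)])
    fix i assume "i \<in> I"
    then show "asdim_le (X i) (d i) (the_enat (asdim (X i) (d i)))"
      using that(2) by (intro asdim_attained fin) auto
  qed
  have asdim_fin: "asdim (PiE {1..k} X) (dist_on d {1..k}) < \<infinity>" for k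
  proof -
    obtain m where "asdim_le (PiE {1..k} X) (dist_on d {1..k}) m"
      using ex_asdim_le[of "{1..k}"] by auto
    then have "asdim (PiE {1..k} X) (dist_on d {1..k}) \<le> enat m" by (rule asdim_le_imp_asdim_le)
    then show ?thesis by (rule le_less_trans) simp
  qed
  define \<alpha> where "\<alpha> k = the_enat (asdim (PiE {1..k} X) (dist_on d {1..k}))" for k
  have \<alpha>: "asdim_le (PiE {1..k} X) (dist_on d {1..k}) (\<alpha> k)" for k
    unfolding \<alpha>_def by (rule asdim_attained[OF asdim_fin])
  have \<alpha>_mono: "\<alpha> k \<le> \<alpha> k'" if "k \<le> k'" for k k'
  proof -
    have "asdim_le (PiE {1..k} X) (dist_on d {1..k}) (\<alpha> k')"
      by (rule asdim_le_subproduct[OF \<alpha>]) (use that ne ipm in auto)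
    then have "asdim (PiE {1..k} X) (dist_on d {1..k}) \<le> enat (\<alpha> k')"
      by (rule asdim_le_imp_asdim_le)
    then show ?thesis
      unfolding \<alpha>_def[of k] using asdim_fin[of k] by (cases "asdim (PiE {1..k} X) (dist_on d {1..k})") auto
  qed
  let ?X = "PiE {1..} X" and ?d = "dist_on d {1..}"
  have ipm_prod: "inf_pseudo_metric ?X ?d"
    by (rule inf_pseudo_metric_dist_on) (use ipm in auto)
  have "\<exists>Z0 Z1. ?X = Z0 \<union> Z1 \<and> scale_dim_zero ?X ?d (real r0) Z0 \<and>
          scale_dim_less ?X ?d (real r1) Z1 (\<alpha> r0)"
    if r: "1 \<le> r0" "r0 \<le> r1" for r0 r1 :: nat
  proof -
    let ?P = "PiE {1..r0} X" and ?dP = "dist_on d {1..r0}"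
    let ?Q = "PiE {r0<..r1} X" and ?dQ = "dist_on d {r0<..r1}"
    define n where "n = \<alpha> r0"
    have scale: "2 * real r1 > 0" using r by simp
    have ipm_P: "inf_pseudo_metric ?P ?dP"
      by (rule inf_pseudo_metric_dist_on) (use ipm in auto)
    have ipm_Q: "inf_pseudo_metric ?Q ?dQ"
      by (rule inf_pseudo_metric_dist_on) (use ipm in auto)
    \<comment> \<open>The number of pieces of \<open>?Q\<close> has no relation to \<open>n\<close>.
      One wall in \<open>?P\<close> is taken for each piece, and \<open>n\<close> colours suffice
      for any number of walls.\<close>
    obtain m where "asdim_le ?Q ?dQ m" using ex_asdim_le[of "{r0<..r1}"] by fastforce
    then obtain B where B: "?Q = (\<Union>j\<le>m. B j)" "\<And>j. j \<le> m \<Longrightarrow> zero_dim_at ?dQ (2 * real r1) (B j)"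
      unfolding asdim_le_iff_zero_dim_at using scale by blast
    obtain D A where
      D: "\<forall>j\<le>m. zero_dim_at ?dP (2 * real r1) (D j)" and
      cover: "\<forall>j\<le>m. ?P = D j \<union> (\<Union>a<n. A j a)" and
      A: "\<forall>j\<le>m. \<forall>a<n. zero_dim_at ?dP (2 * real r1) (A j a)" and
      apart: "\<forall>j'\<le>m. \<forall>j<j'. \<forall>a<n. \<forall>p\<in>A j a. \<forall>p'\<in>A j' a. ennreal (2 * real r1) \<le> ?dP p p'"
      unfolding n_def by (rule walls_in_general_position[OF ipm_P \<alpha> scale])
    define p where "p x = restrict x {1..r0}" for x :: "nat \<Rightarrow> 'a"
    define q where "q x = restrict x {r0<..r1}" for x :: "nat \<Rightarrow> 'a"
    \<comment> \<open>The pieces \<open>B j\<close> may overlap; the least index assigns to each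
      point a single wall, depending on \<open>q x\<close> only.\<close>
    define J where "J y = (LEAST j. j \<le> m \<and> y \<in> B j)" for y
    have p: "p x \<in> ?P" and q: "q x \<in> ?Q" if "x \<in> ?X" for x
      using that r unfolding p_def q_def by (auto simp: PiE_iff)
    have J: "J (q x) \<le> m" "q x \<in> B (J (q x))" if "x \<in> ?X" for x
    proof -
      have "\<exists>j. j \<le> m \<and> q x \<in> B j" using q[OF that] B(1) by blast
      then have "J (q x) \<le> m \<and> q x \<in> B (J (q x))" unfolding J_def by (rule LeastI_ex)
      then show "J (q x) \<le> m" "q x \<in> B (J (q x))" by auto
    qed
    have dP_le: "?dP (p x) (p y) \<le> ?d x y" for x y
    proof -
      have "?dP (p x) (p y) = N {1..r0} (\<lambda>i. d i (x i) (y i))"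
        unfolding dist_on_def p_def by (intro norm_cong) simp
      also have "\<dots> \<le> ?d x y" unfolding dist_on_def by (rule norm_subset) auto
      finally show ?thesis .
    qed
    have dQ_le: "?dQ (q x) (q y) \<le> ?d x y" for x y
    proof -
      have "?dQ (q x) (q y) = N {r0<..r1} (\<lambda>i. d i (x i) (y i))"
        unfolding dist_on_def q_def by (intro norm_cong) simp
      also have "\<dots> \<le> ?d x y" unfolding dist_on_def by (rule norm_subset) auto
      finally show ?thesis .
    qed
    \<comment> \<open>Distinct values of coordinate \<open>i\<close> are at least
      \<open>2 * i\<close> apart, so a distance below \<open>2 * s\<close> fixes every coordinate
      from \<open>s\<close> on, \<open>s\<close> included.\<close>
    have near_eq: "x i = y i"
      if "x \<in> ?X" "y \<in> ?X" "?d x y < ennreal (2 * real s)" "s \<le> i" "1 \<le> i" for x y s i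
    proof (rule ccontr)
      assume "x i \<noteq> y i"
      have "x i \<in> X i" "y i \<in> X i" using that by (auto simp: PiE_iff)
      then have "ennreal (2 * real i) \<le> d i (x i) (y i)"
        using discrete[OF \<open>1 \<le> i\<close>] \<open>x i \<noteq> y i\<close> unfolding discrete_space_def by blast
      also have "\<dots> \<le> ?d x y"
        unfolding dist_on_def using norm_component[of i "{1..}" "\<lambda>i. d i (x i) (y i)"] \<open>1 \<le> i\<close> by simp
      also have "\<dots> < ennreal (2 * real s)" by fact
      also have "\<dots> \<le> ennreal (2 * real i)" using \<open>s \<le> i\<close> by (intro ennreal_leI) simp
      finally show False by simp
    qed
    \<comment> \<open>Only the coordinates up to \<open>r1\<close> contribute, each at most
      \<open>S\<close>.\<close>
    have bound: "?d x y \<le> ennreal (real r1 * S)"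
      if "x \<in> ?X" "y \<in> ?X" "S \<ge> 0" "\<And>i. r1 < i \<Longrightarrow> x i = y i"
        "?dP (p x) (p y) \<le> ennreal S" "?dQ (q x) (q y) \<le> ennreal S" for x y S
    proof -
      have "d i (x i) (y i) \<le> ennreal S" if "i \<in> {1..r1}" for i
      proof (cases "i \<le> r0")
        case True
        then have "d i (p x i) (p y i) \<le> ?dP (p x) (p y)"
          unfolding dist_on_def using norm_component[of i "{1..r0}" "\<lambda>i. d i (p x i) (p y i)"] \<open>i \<in> {1..r1}\<close>
          by simp
        then show ?thesis
          using True that \<open>?dP (p x) (p y) \<le> ennreal S\<close> unfolding p_def by (auto intro: order_trans)
      next
        case False
        then have "d i (q x i) (q y i) \<le> ?dQ (q x) (q y)"
          unfolding dist_on_def using norm_component[of i "{r0<..r1}" "\<lambda>i. d i (q x i) (q y i)"] \<open>i \<in> {1..r1}\<close>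
          by simp
        then show ?thesis
          using False that \<open>?dQ (q x) (q y) \<le> ennreal S\<close> unfolding q_def by (auto intro: order_trans)
      qed
      then have sum: "(\<Sum>i\<in>{1..r1}. d i (x i) (y i)) \<le> (\<Sum>i\<in>{1..r1}. ennreal S)"
        by (intro sum_mono) blast
      have "d i (x i) (y i) = 0" if "i \<in> {1..} - {1..r1}" for i
      proof -
        have i: "1 \<le> i" "r1 < i" using that by auto
        then have "y i \<in> X i" using \<open>y \<in> ?X\<close> by (auto simp: PiE_iff)
        then show ?thesis using ipm_refl[OF ipm[OF i(1)]] \<open>r1 < i \<Longrightarrow> x i = y i\<close> i(2) by simp
      qed
      then have "?d x y = N {1..r1} (\<lambda>i. d i (x i) (y i))"
        unfolding dist_on_def by (intro norm_support) auto
      also have "\<dots> \<le> (\<Sum>i\<in>{1..r1}. d i (x i) (y i))" by (rule norm_le_sum) simp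
      also have "\<dots> \<le> (\<Sum>i\<in>{1..r1}. ennreal S)" by (rule sum)
      also have "\<dots> = ennreal (real r1 * S)"
        using \<open>S \<ge> 0\<close> by (simp add: ennreal_mult ennreal_of_nat_eq_real_of_nat)
      finally show ?thesis .
    qed
    have fin_m: "finite {..m}" by simp
    define Z0 where "Z0 = {x \<in> ?X. p x \<in> D (J (q x))}"
    define F where "F a = {x \<in> ?X. p x \<in> A (J (q x)) a}" for a
    have "?X = Z0 \<union> (\<Union>a<n. F a)"
    proof -
      have "x \<in> Z0 \<union> (\<Union>a<n. F a)" if "x \<in> ?X" for x
        using p[OF that] cover[rule_format, OF J(1)[OF that]] that unfolding Z0_def F_def by auto
      then show ?thesis unfolding Z0_def F_def by blast
    qed
    moreover have "scale_dim_zero ?X ?d (real r0) Z0"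
    proof (rule zero_dim_at_imp_scale_dim_zero[OF ipm_prod])
      have "zero_dim_at ?dP (2 * real r1) (D j)" if "j \<in> {..m}" for j using D that by simp
      from fin_m this obtain f :: "nat \<Rightarrow> (nat \<Rightarrow> 'a) \<Rightarrow> (nat \<Rightarrow> 'a) set" and S :: real where "S \<ge> 0"
        and f_all: "\<forall>j\<in>{..m}. \<forall>x\<in>D j. \<forall>y\<in>D j. ?dP x y < ennreal (2 * real r1) \<longrightarrow> f j x = f j y"
        and S_all: "\<forall>j\<in>{..m}. \<forall>x\<in>D j. \<forall>y\<in>D j. f j x = f j y \<longrightarrow> ?dP x y \<le> ennreal S"
        by (rule zero_dim_at_uniform)
      \<comment> \<open>A step below \<open>2 * r0\<close> fixes the coordinates beyond
        \<open>r0\<close>, hence \<open>q x\<close> and the index \<open>J (q x)\<close>. Only one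
        \<open>D j\<close> is then involved, and its label controls the part in
        \<open>?P\<close>.\<close>
      show "zero_dim_at ?d (2 * real r0) Z0"
      proof (rule zero_dim_atI[where f = "\<lambda>x. (restrict x {r0<..}, f (J (q x)) (p x))" and S = "real r1 * S"])
        fix x y assume xy: "x \<in> Z0" "y \<in> Z0" and near: "?d x y < ennreal (2 * real r0)"
        have X': "x \<in> ?X" "y \<in> ?X" using xy unfolding Z0_def by auto
        have tail: "x i = y i" if "r0 < i" for i
          using near_eq[OF X' near, of i] that by simp
        then have "restrict x {r0<..} = restrict y {r0<..}" by (intro restrict_ext) simp
        moreover have "q x = q y" unfolding q_def using tail by (intro restrict_ext) simp
        moreover have "?dP (p x) (p y) < ennreal (2 * real r1)"
        proof -
          have "?dP (p x) (p y) < ennreal (2 * real r0)" using dP_le near by (rule le_less_trans)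
          also have "\<dots> \<le> ennreal (2 * real r1)" using r by (intro ennreal_leI) simp
          finally show ?thesis .
        qed
        ultimately show "(restrict x {r0<..}, f (J (q x)) (p x)) = (restrict y {r0<..}, f (J (q y)) (p y))"
          using f_all J(1)[OF X'(2)] xy unfolding Z0_def by simp
      next
        fix x y assume xy: "x \<in> Z0" "y \<in> Z0"
          and eq: "(restrict x {r0<..}, f (J (q x)) (p x)) = (restrict y {r0<..}, f (J (q y)) (p y))"
        have X': "x \<in> ?X" "y \<in> ?X" using xy unfolding Z0_def by auto
        have tail: "x i = y i" if "r0 < i" for i
        proof -
          have "restrict x {r0<..} i = restrict y {r0<..} i" using eq by simp
          with that show ?thesis by simp
        qed
        then have "q x = q y" unfolding q_def by (intro restrict_ext) simp
        then have "?dQ (q x) (q y) = 0" using ipm_refl[OF ipm_Q q[OF X'(2)]] by simp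
        moreover have "?dP (p x) (p y) \<le> ennreal S"
          using S_all J(1)[OF X'(2)] xy eq \<open>q x = q y\<close> unfolding Z0_def by simp
        ultimately show "?d x y \<le> ennreal (real r1 * S)"
          using r tail by (intro bound[OF X' \<open>S \<ge> 0\<close>]) auto
      qed
    qed (use r in \<open>auto simp: Z0_def\<close>)
    moreover have "scale_dim_zero ?X ?d (real r1) (F a)" if "a < n" for a
    proof (rule zero_dim_at_imp_scale_dim_zero[OF ipm_prod])
      have "zero_dim_at ?dP (2 * real r1) (A j a)" if "j \<in> {..m}" for j using A \<open>a < n\<close> that by simp
      from fin_m this obtain f :: "nat \<Rightarrow> (nat \<Rightarrow> 'a) \<Rightarrow> (nat \<Rightarrow> 'a) set" and S :: real where "S \<ge> 0"
        and f_all: "\<forall>j\<in>{..m}. \<forall>x\<in>A j a. \<forall>y\<in>A j a. ?dP x y < ennreal (2 * real r1) \<longrightarrow> f j x = f j y"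
        and S_all: "\<forall>j\<in>{..m}. \<forall>x\<in>A j a. \<forall>y\<in>A j a. f j x = f j y \<longrightarrow> ?dP x y \<le> ennreal S"
        by (rule zero_dim_at_uniform)
      have "zero_dim_at ?dQ (2 * real r1) (B j)" if "j \<in> {..m}" for j using B(2) that by simp
      from fin_m this obtain g :: "nat \<Rightarrow> (nat \<Rightarrow> 'a) \<Rightarrow> (nat \<Rightarrow> 'a) set" and S' :: real where "S' \<ge> 0"
        and g_all: "\<forall>j\<in>{..m}. \<forall>x\<in>B j. \<forall>y\<in>B j. ?dQ x y < ennreal (2 * real r1) \<longrightarrow> g j x = g j y"
        and S'_all: "\<forall>j\<in>{..m}. \<forall>x\<in>B j. \<forall>y\<in>B j. g j x = g j y \<longrightarrow> ?dQ x y \<le> ennreal S'"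
        by (rule zero_dim_at_uniform)
      \<comment> \<open>Recording \<open>J (q x)\<close> makes the labels from \<open>f\<close> and
        \<open>g\<close> comparable on a fibre, since both belong to the same index there.\<close>
      let ?f = "\<lambda>x. (restrict x {r1<..}, J (q x), f (J (q x)) (p x), g (J (q x)) (q x))"
      show "zero_dim_at ?d (2 * real r1) (F a)"
      proof (rule zero_dim_atI[where f = ?f and S = "real r1 * (S + S')"])
        fix x y assume xy: "x \<in> F a" "y \<in> F a" and near: "?d x y < ennreal (2 * real r1)"
        have X': "x \<in> ?X" "y \<in> ?X" and A': "p x \<in> A (J (q x)) a" "p y \<in> A (J (q y)) a"
          using xy unfolding F_def by auto
        have "restrict x {r1<..} = restrict y {r1<..}"
          using near_eq[OF X' near] by (intro restrict_ext) simp
        moreover have near_P: "?dP (p x) (p y) < ennreal (2 * real r1)"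
          using dP_le near by (rule le_less_trans)
        moreover have near_Q: "?dQ (q x) (q y) < ennreal (2 * real r1)"
          using dQ_le near by (rule le_less_trans)
        \<comment> \<open>The projections to \<open>?P\<close> are less than
          \<open>2 * real r1\<close> apart and have the same colour \<open>a\<close>, so by general
          position they belong to the same wall. \<open>apart\<close> is stated for
          \<open>j < j'\<close>, hence the two cases.\<close>
        moreover have "J (q x) = J (q y)"
        proof (cases "J (q x)" "J (q y)" rule: linorder_cases)
          case less
          then show ?thesis using apart[rule_format, OF J(1)[OF X'(2)] less \<open>a < n\<close> A'] near_P by simp
        next
          case greater
          then show ?thesis
            using apart[rule_format, OF J(1)[OF X'(1)] greater \<open>a < n\<close> A'(2,1)] near_P
              ipm_sym[OF ipm_P p[OF X'(1)] p[OF X'(2)]] by simp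
        qed
        ultimately show "?f x = ?f y"
          using f_all g_all J[OF X'(1)] J[OF X'(2)] A' by simp
      next
        fix x y assume xy: "x \<in> F a" "y \<in> F a" and eq: "?f x = ?f y"
        have X': "x \<in> ?X" "y \<in> ?X" and A': "p x \<in> A (J (q x)) a" "p y \<in> A (J (q y)) a"
          using xy unfolding F_def by auto
        have tail: "x i = y i" if "r1 < i" for i
        proof -
          have "restrict x {r1<..} i = restrict y {r1<..} i" using eq by simp
          with that show ?thesis by simp
        qed
        have J_eq: "J (q y) = J (q x)" using eq by simp
        have f_eq: "f (J (q x)) (p x) = f (J (q x)) (p y)"
          and g_eq: "g (J (q x)) (q x) = g (J (q x)) (q y)"
          using eq unfolding J_eq by simp_all
        have "?dP (p x) (p y) \<le> ennreal S"
          using S_all J[OF X'(1)] A' f_eq unfolding J_eq by simp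
        also have "\<dots> \<le> ennreal (S + S')" using \<open>S' \<ge> 0\<close> by (intro ennreal_leI) simp
        finally have bP: "?dP (p x) (p y) \<le> ennreal (S + S')" .
        have "?dQ (q x) (q y) \<le> ennreal S'"
          using S'_all J[OF X'(1)] J[OF X'(2)] g_eq unfolding J_eq by simp
        also have "\<dots> \<le> ennreal (S + S')" using \<open>S \<ge> 0\<close> by (intro ennreal_leI) simp
        finally have bQ: "?dQ (q x) (q y) \<le> ennreal (S + S')" .
        show "?d x y \<le> ennreal (real r1 * (S + S'))"
          using \<open>S \<ge> 0\<close> \<open>S' \<ge> 0\<close> by (intro bound[OF X' _ tail bP bQ]) auto
      qed
    qed (use r in \<open>auto simp: F_def\<close>)
    then have "scale_dim_less ?X ?d (real r1) (\<Union>a<n. F a) (\<alpha> r0)"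
      unfolding scale_dim_less_def n_def by (intro exI[of _ F]) simp
    ultimately show ?thesis by (intro exI conjI)
  qed
  then have "integral_APD_profile_1 ?X ?d \<alpha>"
    unfolding integral_APD_profile_1_def using \<alpha>_mono by (auto intro: mono_onI)
  then show ?thesis using asdim_fin unfolding \<alpha>_def by blast
qed

end

section \<open>The sum and the supremum over index sets\<close>

lemma family_norm_infsum: "family_norm (\<lambda>I u. infsum u I)"
proof
  fix I J :: "nat set" and u v :: "nat \<Rightarrow> ennreal" and i :: nat
  note summ = nonneg_summable_on_complete
  show "infsum u I = infsum v I" if "\<And>i. i \<in> I \<Longrightarrow> u i = v i"
    using that by (rule infsum_cong)
  show "infsum u I \<le> infsum v I" if "\<And>i. i \<in> I \<Longrightarrow> u i \<le> v i"
    using that by (intro infsum_mono summ) auto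
  show "(\<Sum>\<^sub>\<infinity>i\<in>I. u i + v i) \<le> infsum u I + infsum v I"
    by (subst infsum_add) (auto intro: summ)
  show subset: "infsum u J \<le> infsum u I" if "J \<subseteq> I" for u :: "nat \<Rightarrow> ennreal" and J I
    using that by (intro infsum_mono_neutral summ) auto
  show "u i \<le> infsum u I" if "i \<in> I"
    using subset[of "{i}" I u] that by simp
  show "infsum u I \<le> sum u I" if "finite I" using that by simp
  show "infsum u I = infsum u J" if "J \<subseteq> I" "\<And>i. i \<in> I - J \<Longrightarrow> u i = 0"
    using that by (intro infsum_cong_neutral) auto
qed

lemma family_norm_Sup: "family_norm (\<lambda>I u. SUP i\<in>I. u i)"
proof
  fix I J :: "nat set" and u v :: "nat \<Rightarrow> ennreal" and i :: nat
  show "(SUP i\<in>I. u i) = (SUP i\<in>I. v i)" if "\<And>i. i \<in> I \<Longrightarrow> u i = v i"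
    using that by (rule SUP_cong[OF refl])
  show "(SUP i\<in>I. u i) \<le> (SUP i\<in>I. v i)" if "\<And>i. i \<in> I \<Longrightarrow> u i \<le> v i"
    using that by (intro SUP_mono) blast
  show "(SUP i\<in>I. u i + v i) \<le> (SUP i\<in>I. u i) + (SUP i\<in>I. v i)"
    by (intro SUP_least add_mono SUP_upper)
  show subset: "(SUP i\<in>J. u i) \<le> (SUP i\<in>I. u i)" if "J \<subseteq> I"
    using that by (intro SUP_subset_mono) auto
  show "u i \<le> (SUP i\<in>I. u i)" if "i \<in> I" using that by (rule SUP_upper)
  show "(SUP i\<in>I. u i) \<le> sum u I" if "finite I"
    using that by (intro SUP_least member_le_sum) auto
  \<comment> \<open>As 0 is the least element of \<open>ennreal\<close>, dropping zero entries
    leaves the supremum unchanged, even for empty \<open>J\<close>.\<close>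
  show "(SUP i\<in>I. u i) = (SUP i\<in>J. u i)" if "J \<subseteq> I" "\<And>i. i \<in> I - J \<Longrightarrow> u i = 0"
  proof (rule antisym)
    show "(SUP i\<in>I. u i) \<le> (SUP i\<in>J. u i)"
    proof (rule SUP_least)
      fix i assume "i \<in> I"
      then show "u i \<le> (SUP i\<in>J. u i)"
        using that(2)[of i] by (cases "i \<in> J") (auto intro: SUP_upper)
    qed
  qed (rule subset[OF that(1)])
qed

theorem theorem6p3:
  fixes X :: "nat \<Rightarrow> 'a set" and d :: "nat \<Rightarrow> 'a \<Rightarrow> 'a \<Rightarrow> ennreal"
  assumes "\<And>i. i \<ge> 1 \<Longrightarrow> X i \<noteq> {}"
    and "\<And>i. i \<ge> 1 \<Longrightarrow> inf_pseudo_metric (X i) (d i)"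
    and "\<And>i. i \<ge> 1 \<Longrightarrow> asdim (X i) (d i) < \<infinity>"
    and "\<And>i. i \<ge> 1 \<Longrightarrow> discrete_space (2 * real i) (X i) (d i)"
  shows "((\<forall>k\<ge>1. asdim (PiE {1..k} X) (l1_prod {1..k} d) < \<infinity>) \<and>
          integral_APD_profile_1 (PiE {1..} X) (l1_prod {1..} d)
            (\<lambda>k. the_enat (asdim (PiE {1..k} X) (l1_prod {1..k} d)))) \<and>
         ((\<forall>k\<ge>1. asdim (PiE {1..k} X) (sup_prod {1..k} d) < \<infinity>) \<and>
          integral_APD_profile_1 (PiE {1..} X) (sup_prod {1..} d)
            (\<lambda>k. the_enat (asdim (PiE {1..k} X) (sup_prod {1..k} d))))"
proof -
  interpret l1: family_norm "\<lambda>I u. infsum u I" by (rule family_norm_infsum)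
  interpret sup: family_norm "\<lambda>I u. SUP i\<in>I. u i" by (rule family_norm_Sup)
  have "l1_prod I d = l1.dist_on d I" "sup_prod I d = sup.dist_on d I" for I
    by (auto simp: fun_eq_iff l1_prod_def l1.dist_on_def sup_prod_def sup.dist_on_def)
  then show ?thesis
    using l1.integral_APD_profile_dist_on[OF assms] sup.integral_APD_profile_dist_on[OF assms]
    by simp
qed

end
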